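(* Let $\{\hat f(n)\}_{n=0}^{\infty}\in\mathrm{GBV}$ be a real sequence and let $$f(x)=\sum_{n=0}^{\infty}\hat f(n)\cos nx.$$ If $f\in C_{2\pi}$ and $$\sum_{k=n+1}^{2n}\hat f(k)=O\left(\max_{1\le k\le n}k\hat f(n+k)\right),\qquad n=1,2,\dots,$$ then $$\|f-S_n(f)\|=O(E_n(f)),\qquad n=1,2,\dots,$$ where $S_n(f)$ is the $n$th Fourier partial sum of $f$, i.e. $S_n(f,x)=\sum_{k=0}^{n}\hat f(k)\cos kx$.
   Context: $C_{2\pi}$ is the space of all real or complex valued continuous $2\pi$-periodic functions on $\mathbb{R}$ with norm $\|f\|=\max_{x}|f(x)|$. $E_n(f)$ is the best approximation of $f$ in this norm by trigonometric polynomials of degree at most $n$, i.e. the infimum of $\|f-t\|$ over such $t$. $f(x)$ denotes the sum of the series at any point $x$ where it converges. The statement $f\in C_{2\pi}$ means that the series converges at every $x$ and its sum $f$ belongs to $C_{2\pi}$. $\Delta c_n=c_n-c_{n+1}$. A real sequence $\mathbf c=\{c_n\}$ belongs to the class GBV if $c_n\ge0$ for all $n=1,2,\dots$, and there are a natural number $N_0\ge1$ and a positive constant $M(\mathbf c)$ depending only on $\mathbf c$ such that $$\sum_{n=m}^{2m}|\Delta c_n|\le M(\mathbf c)\max_{m\le n<m+N_0}|c_n|\quad\text{for all } m=1,2,\dots.$$ For a sequence indexed from $n=0$, these conditions are imposed only for indices $n,m\ge1$ as written. The constants implied in $O(\cdot)$ are independent of $n$ (they may depend on $f$). *)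

theory Defs
  imports "HOL-Analysis.Analysis"
begin

definition C2pi :: "(real \<Rightarrow> 'a::real_normed_vector) set" where
  "C2pi = {f. continuous_on UNIV f \<and> (\<forall>x. f (x + 2 * pi) = f x)}"

text \<open>On \<open>C2pi\<close> the supremum below is finite and attained.\<close>

definition sup_norm :: "(real \<Rightarrow> 'a::real_normed_vector) \<Rightarrow> real" where
  "sup_norm f = (SUP x. norm (f x))"

text \<open>The coefficients lie in the space of values, so the instances \<open>real\<close> and
  \<open>complex\<close> give the real and the complex trigonometric polynomials of degree at most \<open>n\<close>.\<close>

definition trig_polys :: "nat \<Rightarrow> (real \<Rightarrow> 'a::real_normed_vector) set" where
  "trig_polys n =
    {t. \<exists>a b. t = (\<lambda>x. \<Sum>k\<le>n. cos (real k * x) *\<^sub>R a k + sin (real k * x) *\<^sub>R b k)}"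

definition best_approx :: "nat \<Rightarrow> (real \<Rightarrow> 'a::real_normed_vector) \<Rightarrow> real" where
  "best_approx n f = (INF t\<in>trig_polys n. sup_norm (\<lambda>x. f x - t x))"

text \<open>The value at index \<open>0\<close> is unconstrained.\<close>

definition GBV :: "(nat \<Rightarrow> real) set" where
  "GBV = {c. (\<forall>n\<ge>1. 0 \<le> c n) \<and>
     (\<exists>N0\<ge>1. \<exists>M>0. \<forall>m\<ge>1.
        (\<Sum>n=m..2*m. \<bar>c n - c (n + 1)\<bar>) \<le> M * Max ((\<lambda>n. \<bar>c n\<bar>) ` {m..<m + N0}))}"

definition cos_partial_sum :: "(nat \<Rightarrow> real) \<Rightarrow> nat \<Rightarrow> real \<Rightarrow> real" where
  "cos_partial_sum c n x = (\<Sum>k\<le>n. c k * cos (real k * x))"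

end

theory Submission
  imports Defs
begin

text \<open>
  Since the coefficients are nonnegative from index \<open>1\<close> on, convergence at \<open>0\<close> makes the series
  converge uniformly, and the error of the \<open>n\<close>th partial sum is at most the sum of the
  coefficients beyond \<open>n\<close>. If \<open>t\<close> has degree at most \<open>n\<close> and \<open>\<bar>f - t\<bar> \<le> B\<close>, integrating \<open>f - t\<close>
  against bounded-mass kernels with nonnegative coefficients that vanish on the frequencies up
  to \<open>n\<close> bounds nonnegatively weighted sums of coefficients by multiples of \<open>B\<close>. A de la Vallee Poussin
  kernel controls the coefficients beyond \<open>2n\<close>; a modulated Fejer kernel together with the GBV
  condition gives \<open>k c\<^sub>n\<^sub>+\<^sub>k = O(B)\<close> for \<open>1 \<le> k \<le> n\<close>, and then the hypothesis controls the block
  from \<open>n + 1\<close> to \<open>2n\<close>. After truncating the series, averages over roots of unity replace the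
  integrals.
\<close>

section \<open>Discrete averages and Fejer kernels\<close>

text \<open>Equispaced nodes integrate trigonometric polynomials of degree below \<open>L\<close>
  exactly, so this replaces the normalised integral over a period.\<close>

definition discrete_mean :: "nat \<Rightarrow> (real \<Rightarrow> real) \<Rightarrow> real" where
  "discrete_mean L h = (\<Sum>l<L. h (2 * pi * real l / real L)) / real L"

text \<open>At \<open>k = 0\<close> division by zero gives the value \<open>0\<close>.\<close>

definition fejer :: "nat \<Rightarrow> real \<Rightarrow> real" where
  "fejer k x = ((\<Sum>a<k. cos (real a * x))\<^sup>2 + (\<Sum>a<k. sin (real a * x))\<^sup>2) / real k"

lemma discrete_mean_add:
  "discrete_mean L (\<lambda>x. g x + h x) = discrete_mean L g + discrete_mean L h"
  by (simp add: discrete_mean_def sum.distrib add_divide_distrib)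

lemma discrete_mean_cmult:
  "discrete_mean L (\<lambda>x. c * h x) = c * discrete_mean L h"
  by (simp add: discrete_mean_def sum_distrib_left)

lemma discrete_mean_divide:
  "discrete_mean L (\<lambda>x. h x / c) = discrete_mean L h / c"
  by (simp add: discrete_mean_def sum_divide_distrib mult.commute)

lemma discrete_mean_sum:
  "discrete_mean L (\<lambda>x. \<Sum>i\<in>I. h i x) = (\<Sum>i\<in>I. discrete_mean L (h i))"
  unfolding discrete_mean_def by (subst sum.swap) (simp add: sum_divide_distrib)

text \<open>For \<open>m \<noteq> 0\<close> this is a geometric sum over powers of an
  \<open>L\<close>th root of unity; \<open>\<bar>m\<bar> < int L\<close> excludes aliasing, so that
  root is not 1.\<close>

lemma discrete_mean_cos:
  fixes m :: int
  assumes "\<bar>m\<bar> < int L"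
  shows "discrete_mean L (\<lambda>x. cos (of_int m * x)) = (if m = 0 then 1 else 0)"
proof (cases "m = 0")
  case True
  then show ?thesis using assms by (simp add: discrete_mean_def)
next
  case False
  have L: "L > 0" using assms by linarith
  define z where "z = cis (2 * pi * of_int m / real L)"
  have "z \<noteq> 1"
  proof
    assume "z = 1"
    then have "cos (2 * pi * of_int m / real L) = 1"
      by (metis z_def cis.sel(1) one_complex.sel(1))
    then obtain i :: int where "2 * pi * of_int m / real L = of_int i * 2 * pi"
      by (auto simp: cos_one_2pi_int)
    then have "real_of_int m = of_int (i * int L)"
      using L by (simp add: field_simps)
    then have "m = i * int L" by linarith
    then have "\<bar>m\<bar> = \<bar>i\<bar> * int L" by (simp add: abs_mult)
    moreover have "\<bar>i\<bar> \<ge> 1" using \<open>m = i * int L\<close> False by auto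
    ultimately have "\<bar>m\<bar> \<ge> int L" using L by simp
    then show False using assms by simp
  qed
  have "z ^ L = cis (real L * (2 * pi * of_int m / real L))"
    by (simp only: z_def Complex.DeMoivre)
  also have "real L * (2 * pi * of_int m / real L) = 2 * pi * of_int m"
    using L by simp
  also have "cis \<dots> = 1" by (simp add: cis_multiple_2pi)
  finally have "(\<Sum>l<L. z ^ l) = 0"
    using \<open>z \<noteq> 1\<close> by (simp add: sum_gp_strict)
  then have "0 = (\<Sum>l<L. Re (z ^ l))" by (metis Re_sum zero_complex.sel(1))
  also have "\<dots> = (\<Sum>l<L. cos (of_int m * (2 * pi * real l / real L)))"
    by (intro sum.cong) (auto simp: z_def Complex.DeMoivre algebra_simps)
  finally show ?thesis using False by (simp add: discrete_mean_def)
qed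

lemma fejer_nonneg: "0 \<le> fejer k x"
  by (simp add: fejer_def)

lemma fejer_expand:
  "fejer k x = (\<Sum>a<k. \<Sum>b<k. cos (of_int (int a - int b) * x)) / real k"
proof -
  have "(\<Sum>a<k. cos (real a * x))\<^sup>2 + (\<Sum>a<k. sin (real a * x))\<^sup>2
     = (\<Sum>a<k. \<Sum>b<k. cos (real a * x) * cos (real b * x) + sin (real a * x) * sin (real b * x))"
    by (simp add: power2_eq_square sum_product sum.distrib)
  also have "\<dots> = (\<Sum>a<k. \<Sum>b<k. cos (of_int (int a - int b) * x))"
    by (simp add: cos_diff left_diff_distrib)
  finally show ?thesis by (simp add: fejer_def)
qed

text \<open>Each row of the grid meets the diagonal \<open>b = j + a\<close> at most once. Divided
  by \<open>k\<close>, these counts are the triangular Fejer coefficients.\<close>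

lemma sum_diagonal_count:
  fixes j :: int
  shows "(\<Sum>a<k. \<Sum>b<k. if j + int a - int b = 0 then 1 else 0 :: real)
    = max 0 (real k - of_int \<bar>j\<bar>)"
proof -
  have "(\<Sum>b<k. if j + int a - int b = 0 then 1 else 0 :: real)
      = (if a \<in> {nat (- j)..<nat (int k - j)} then 1 else 0)" for a
  proof (cases "0 \<le> j + int a \<and> j + int a < int k")
    case True
    have "(\<Sum>b<k. if j + int a - int b = 0 then 1 else 0 :: real)
        = (\<Sum>b<k. if b = nat (j + int a) then 1 else 0)"
      using True by (intro sum.cong) auto
    also have "\<dots> = 1" using True by (auto simp: sum.delta)
    finally show ?thesis using True by auto
  next
    case False
    then have "(\<Sum>b<k. if j + int a - int b = 0 then 1 else 0 :: real) = 0"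
      by (intro sum.neutral) auto
    then show ?thesis using False by auto
  qed
  then have "(\<Sum>a<k. \<Sum>b<k. if j + int a - int b = 0 then 1 else 0 :: real)
      = (\<Sum>a<k. if a \<in> {nat (- j)..<nat (int k - j)} then 1 else 0)" by simp
  also have "\<dots> = real (card ({..<k} \<inter> {nat (- j)..<nat (int k - j)}))"
    by (simp add: sum.If_cases Int_def)
  also have "{..<k} \<inter> {nat (- j)..<nat (int k - j)} = {nat (- j)..<min k (nat (int k - j))}"
    by auto
  also have "real (card \<dots>) = max 0 (real k - of_int \<bar>j\<bar>)"
    by (cases "j \<ge> 0") (auto simp: min_def max_def)
  finally show ?thesis .
qed

text \<open>The product formula turns the mean into counts of pairs with \<open>a - b\<close> equal
  to plus or minus \<open>j\<close>. The frequencies stay below \<open>L\<close> in modulus because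
  \<open>\<bar>a - b\<bar> < k\<close>.\<close>

lemma discrete_mean_cos_fejer:
  fixes j :: int
  assumes "\<bar>j\<bar> + int k \<le> int L"
  shows "discrete_mean L (\<lambda>x. cos (of_int j * x) * fejer k x)
    = max 0 (real k - of_int \<bar>j\<bar>) / real k"
proof -
  have cc: "cos (of_int j * x) * cos (of_int (int a - int b) * x)
    = (cos (of_int (j + int a - int b) * x) + cos (of_int (j + int b - int a) * x)) / 2" for a b and x :: real
    by (simp add: cos_times_cos algebra_simps)
  have m: "discrete_mean L (\<lambda>x. cos (of_int (j + int a - int b) * x)) = (if j + int a - int b = 0 then 1 else 0)"
    if "a < k" "b < k" for a b
    using that assms by (intro discrete_mean_cos) linarith
  have sw: "(\<Sum>a<k. \<Sum>b<k. if j + int b - int a = 0 then 1 else 0 :: real)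
      = (\<Sum>a<k. \<Sum>b<k. if j + int a - int b = 0 then 1 else 0)"
    by (rule sum.swap)
  have "discrete_mean L (\<lambda>x. cos (of_int j * x) * fejer k x)
     = (\<Sum>a<k. \<Sum>b<k. (discrete_mean L (\<lambda>x. cos (of_int (j + int a - int b) * x))
        + discrete_mean L (\<lambda>x. cos (of_int (j + int b - int a) * x))) / 2) / real k"
    unfolding fejer_expand times_divide_eq_right sum_distrib_left cc
      discrete_mean_divide discrete_mean_sum discrete_mean_add ..
  also have "\<dots> = (\<Sum>a<k. \<Sum>b<k. ((if j + int a - int b = 0 then 1 else 0)
        + (if j + int b - int a = 0 then 1 else 0)) / 2) / real k"
    by (intro arg_cong2[where f = "(/)"] sum.cong refl) (simp_all only: m lessThan_iff)
  also have "\<dots> = ((\<Sum>a<k. \<Sum>b<k. if j + int a - int b = 0 then 1 else 0)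
        + (\<Sum>a<k. \<Sum>b<k. if j + int b - int a = 0 then 1 else 0)) / 2 / real k"
    unfolding add_divide_distrib sum.distrib sum_divide_distrib ..
  also have "\<dots> = max 0 (real k - of_int \<bar>j\<bar>) / real k"
    unfolding sw sum_diagonal_count by simp
  finally show ?thesis .
qed

text \<open>The kernel is nonnegative and has mean one, the case \<open>j = 0\<close> of the
  coefficient formula.\<close>

lemma discrete_mean_fejer_le:
  assumes "0 < k" "k \<le> L" "\<And>x. \<bar>h x\<bar> \<le> B"
  shows "\<bar>discrete_mean L (\<lambda>x. h x * fejer k x)\<bar> \<le> B"
proof -
  define y where "y l = 2 * pi * real l / real L" for l
  have "\<bar>\<Sum>l<L. h (y l) * fejer k (y l)\<bar> \<le> (\<Sum>l<L. B * fejer k (y l))"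
    by (rule order_trans[OF sum_abs])
       (intro sum_mono, simp add: abs_mult fejer_nonneg mult_right_mono assms)
  then have "\<bar>discrete_mean L (\<lambda>x. h x * fejer k x)\<bar> \<le> discrete_mean L (\<lambda>x. B * fejer k x)"
    by (simp add: discrete_mean_def y_def divide_right_mono)
  also have "\<dots> = B"
    using discrete_mean_cos_fejer[of 0 k L] assms by (simp add: discrete_mean_cmult)
  finally show ?thesis .
qed

lemma discrete_mean_cos_poly_fejer:
  assumes "J + k \<le> L"
  shows "discrete_mean L (\<lambda>x. (\<Sum>j\<le>J. d j * cos (real j * x)) * fejer k x)
    = (\<Sum>j\<le>J. d j * (max 0 (real k - real j) / real k))"
proof -
  have "discrete_mean L (\<lambda>x. (\<Sum>j\<le>J. d j * cos (real j * x)) * fejer k x)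
     = (\<Sum>j\<le>J. d j * discrete_mean L (\<lambda>x. cos (of_int (int j) * x) * fejer k x))"
    by (simp add: sum_distrib_right mult.assoc discrete_mean_sum discrete_mean_cmult)
  also have "\<dots> = (\<Sum>j\<le>J. d j * (max 0 (real k - real j) / real k))"
    using assms by (intro sum.cong refl, subst discrete_mean_cos_fejer) auto
  finally show ?thesis .
qed

text \<open>Modulation centres the triangle at \<open>N\<close> and halves it: with
  \<open>k \<le> N\<close> the frequency \<open>j + N\<close> contributes nothing.\<close>

lemma discrete_mean_cos_poly_shifted_fejer:
  assumes "J + N + k \<le> L" "k \<le> N"
  shows "discrete_mean L (\<lambda>x. (\<Sum>j\<le>J. d j * cos (real j * x)) * cos (real N * x) * fejer k x)
    = (\<Sum>j\<le>J. d j * (max 0 (real k - \<bar>real j - real N\<bar>) / (2 * real k)))"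
proof -
  have cc: "cos (real j * x) * cos (real N * x) * fejer k x
    = (cos (of_int (int j - int N) * x) * fejer k x + cos (of_int (int j + int N) * x) * fejer k x) / 2" for j x
    by (simp only: cos_times_cos) (simp add: algebra_simps)
  have "discrete_mean L (\<lambda>x. (\<Sum>j\<le>J. d j * cos (real j * x)) * cos (real N * x) * fejer k x)
     = discrete_mean L (\<lambda>x. (\<Sum>j\<le>J. d j * (cos (real j * x) * cos (real N * x) * fejer k x)))"
    by (simp add: sum_distrib_right mult.assoc)
  also have "\<dots> = (\<Sum>j\<le>J. d j * ((discrete_mean L (\<lambda>x. cos (of_int (int j - int N) * x) * fejer k x)
       + discrete_mean L (\<lambda>x. cos (of_int (int j + int N) * x) * fejer k x)) / 2))"
    unfolding cc discrete_mean_sum discrete_mean_cmult discrete_mean_divide discrete_mean_add ..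
  also have "\<dots> = (\<Sum>j\<le>J. d j * (max 0 (real k - \<bar>real j - real N\<bar>) / (2 * real k)))"
  proof (intro sum.cong refl)
    fix j assume "j \<in> {..J}"
    then have 1: "\<bar>int j - int N\<bar> + int k \<le> int L" and 2: "\<bar>int j + int N\<bar> + int k \<le> int L"
      using assms by auto
    show "d j * ((discrete_mean L (\<lambda>x. cos (of_int (int j - int N) * x) * fejer k x)
       + discrete_mean L (\<lambda>x. cos (of_int (int j + int N) * x) * fejer k x)) / 2)
       = d j * (max 0 (real k - \<bar>real j - real N\<bar>) / (2 * real k))"
      unfolding discrete_mean_cos_fejer[OF 1] discrete_mean_cos_fejer[OF 2]
      using assms(2) by simp
  qed
  finally show ?thesis .
qed

section \<open>Coefficient bounds for cosine polynomials\<close>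

text \<open>Test against the point mass at \<open>0\<close> minus the de la Vallee Poussin kernel
  \<open>2 F\<^sub>2\<^sub>n - F\<^sub>n\<close>: it annihilates the frequencies \<open>j \<le> n\<close>.\<close>

lemma cos_poly_tail_le:
  assumes "1 \<le> n" "\<And>x. \<bar>\<Sum>j\<le>J. d j * cos (real j * x)\<bar> \<le> B" "\<And>j. n < j \<Longrightarrow> 0 \<le> d j"
  shows "(\<Sum>j=2*n+1..J. d j) \<le> 4 * B"
proof -
  define h where "h x = (\<Sum>j\<le>J. d j * cos (real j * x))" for x
  define L where "L = J + 2 * n"
  \<comment> \<open>The multiplier of this kernel: 0 up to \<open>n\<close>, linear from
    \<open>n\<close> to \<open>2 * n\<close>, and 1 beyond.\<close>
  define v where "v j = 1 - 2 * (max 0 (real (2*n) - real j) / real (2*n)) + max 0 (real n - real j) / real n" for j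
  have hB: "\<And>x. \<bar>h x\<bar> \<le> B" using assms(2) by (simp add: h_def)
  have v0: "v j = 0" if "j \<le> n" for j
    using that assms(1) by (auto simp: v_def max_def field_simps)
  have v1: "0 \<le> v j" if "n < j" for j
    using that assms(1) by (auto simp: v_def max_def field_simps)
  have v2: "v j = 1" if "2 * n < j" for j
    using that assms(1) by (auto simp: v_def max_def field_simps)
  have "(\<Sum>j=2*n+1..J. d j) = (\<Sum>j=2*n+1..J. d j * v j)"
    by (intro sum.cong) (auto simp: v2)
  also have "\<dots> \<le> (\<Sum>j\<le>J. d j * v j)"
  proof (intro sum_mono2)
    fix j show "0 \<le> d j * v j"
      by (cases "j \<le> n") (simp_all add: v0 v1 assms(3))
  qed auto
  also have "\<dots> = (\<Sum>j\<le>J. d j) - 2 * (\<Sum>j\<le>J. d j * (max 0 (real (2*n) - real j) / real (2*n)))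
       + (\<Sum>j\<le>J. d j * (max 0 (real n - real j) / real n))"
    by (simp only: v_def sum_distrib_left sum_subtractf[symmetric] sum.distrib[symmetric])
       (intro sum.cong, simp_all only: algebra_simps)
  also have "\<dots> = h 0 - 2 * discrete_mean L (\<lambda>x. h x * fejer (2*n) x) + discrete_mean L (\<lambda>x. h x * fejer n x)"
    unfolding h_def
    by (subst (1 2) discrete_mean_cos_poly_fejer) (simp_all add: L_def)
  \<comment> \<open>Evaluation at 0 and the two means cost \<open>B\<close>, \<open>2 * B\<close>
    and \<open>B\<close>.\<close>
  also have "\<dots> \<le> 4 * B"
    using hB[of 0] discrete_mean_fejer_le[of "2*n" L h B, OF _ _ hB] discrete_mean_fejer_le[of n L h B, OF _ _ hB] assms(1)
    by (simp add: L_def abs_le_iff)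
  finally show ?thesis .
qed

text \<open>Test against \<open>cos ((n + k) x) F\<^sub>k(x)\<close>, whose spectrum lies above \<open>n\<close>.\<close>

lemma cos_poly_block_le:
  assumes "1 \<le> k" "n + k \<le> J" "\<And>x. \<bar>\<Sum>j\<le>J. d j * cos (real j * x)\<bar> \<le> B"
    and "\<And>j. n < j \<Longrightarrow> 0 \<le> d j"
  shows "(\<Sum>j=n + k - k div 2..n + k. d j) \<le> 4 * B" "d (n + k) \<le> 2 * B"
proof -
  define N where "N = n + k"
  define h where "h x = (\<Sum>j\<le>J. d j * cos (real j * x))" for x
  define L where "L = J + N + k"
  \<comment> \<open>A triangle of height 1/2 around \<open>N\<close>, vanishing from distance
    \<open>k\<close> on, hence for \<open>j \<le> n\<close>.\<close>
  define w where "w j = max 0 (real k - \<bar>real j - real N\<bar>) / (2 * real k)" for j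
  have B: "\<bar>h x * cos (real N * x)\<bar> \<le> B" for x
  proof -
    have "\<bar>h x\<bar> * \<bar>cos (real N * x)\<bar> \<le> \<bar>h x\<bar> * 1" by (intro mult_left_mono) auto
    then show ?thesis using assms(3)[of x] by (simp add: h_def abs_mult)
  qed
  have nonneg: "0 \<le> d j * w j" for j
    using assms(4)[of j] by (cases "j \<le> n") (auto simp: w_def N_def)
  have "(\<Sum>j\<le>J. d j * w j) = discrete_mean L (\<lambda>x. h x * cos (real N * x) * fejer k x)"
    unfolding h_def w_def by (subst discrete_mean_cos_poly_shifted_fejer) (auto simp: L_def N_def)
  also have "\<dots> \<le> B"
    using discrete_mean_fejer_le[of k L "\<lambda>x. h x * cos (real N * x)" B, OF _ _ B] assms(1)
    by (simp add: L_def abs_le_iff)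
  finally have sumB: "(\<Sum>j\<le>J. d j * w j) \<le> B" .
  \<comment> \<open>Within distance \<open>k / 2\<close> of \<open>N\<close> the triangle keeps half
    its height.\<close>
  have "(\<Sum>j=N - k div 2..N. d j) / 4 \<le> (\<Sum>j=N - k div 2..N. d j * w j)"
    unfolding sum_divide_distrib
  proof (intro sum_mono)
    fix j assume j: "j \<in> {N - k div 2..N}"
    then have "real N - real j \<le> real (k div 2)" "j \<le> N" by auto
    moreover have "real (k div 2) \<le> real k / 2" by linarith
    ultimately have "1 / 4 \<le> w j" using assms(1) by (auto simp: w_def field_simps)
    moreover have "0 \<le> d j" using j assms(1) by (intro assms(4)) (auto simp: N_def)
    ultimately show "d j / 4 \<le> d j * w j"
      using mult_left_mono[of "1/4" "w j" "d j"] by simp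
  qed
  also have "\<dots> \<le> (\<Sum>j\<le>J. d j * w j)"
    using assms(2) by (intro sum_mono2 nonneg) (auto simp: N_def)
  finally show "(\<Sum>j=n + k - k div 2..n + k. d j) \<le> 4 * B"
    using sumB by (simp add: N_def)
  have "d N * w N \<le> (\<Sum>j\<le>J. d j * w j)"
    using assms(2) by (intro member_le_sum nonneg) (auto simp: N_def)
  moreover have "w N = 1 / 2" using assms(1) by (simp add: w_def)
  ultimately have "d N * (1 / 2) \<le> B" using sumB by simp
  then show "d (n + k) \<le> 2 * B" by (simp add: N_def)
qed

section \<open>The GBV condition\<close>

text \<open>The variation over \<open>m..2 * m\<close> bounds \<open>c N - c m\<close>. Having a sum
  in place of the maximum over the window allows a later interchange with summation over
  \<open>m\<close>.\<close>

lemma GBV_coeff_le: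
  assumes "c \<in> GBV"
  obtains N0 M where "1 \<le> N0" "0 < M"
    "\<And>m N. 1 \<le> m \<Longrightarrow> m \<le> N \<Longrightarrow> N \<le> 2 * m \<Longrightarrow> c N \<le> M * (\<Sum>i<N0. c (m + i))"
proof -
  from assms obtain N0 :: nat and M where c: "\<And>n. 1 \<le> n \<Longrightarrow> 0 \<le> c n" and N0: "1 \<le> N0" and M: "M > 0"
    and bv: "\<And>m. 1 \<le> m \<Longrightarrow>
        (\<Sum>n=m..2*m. \<bar>c n - c (n + 1)\<bar>) \<le> M * Max ((\<lambda>n. \<bar>c n\<bar>) ` {m..<m + N0})"
    unfolding GBV_def by blast
  \<comment> \<open>In \<open>1 + M\<close> the 1 pays for \<open>c m\<close> and the
    \<open>M\<close> for the variation.\<close>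
  have "c N \<le> (1 + M) * (\<Sum>i<N0. c (m + i))" if "1 \<le> m" "m \<le> N" "N \<le> 2 * m" for m N
  proof -
    define S where "S = (\<Sum>i<N0. c (m + i))"
    have S: "c (m + i) \<le> S" if "i < N0" for i
      unfolding S_def using that \<open>1 \<le> m\<close> by (intro member_le_sum[where f = "\<lambda>i. c (m + i)"]) (auto intro: c)
    have "Max ((\<lambda>n. \<bar>c n\<bar>) ` {m..<m + N0}) \<le> S"
    proof (intro Max.boundedI)
      fix a assume "a \<in> (\<lambda>n. \<bar>c n\<bar>) ` {m..<m + N0}"
      then obtain n where n: "m \<le> n" "n < m + N0" "a = \<bar>c n\<bar>" by auto
      then show "a \<le> S" using S[of "n - m"] c[of n] \<open>1 \<le> m\<close> by simp
    qed (use N0 in auto)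
    then have "(\<Sum>n=m..2*m. \<bar>c n - c (n + 1)\<bar>) \<le> M * S"
      using bv[OF \<open>1 \<le> m\<close>] M by (meson mult_left_mono less_imp_le order_trans)
    moreover have "c N - c m = (\<Sum>n=m..<N. c (Suc n) - c n)"
      using sum_Suc_diff'[OF \<open>m \<le> N\<close>, of c] by simp
    moreover have "(\<Sum>n=m..<N. c (Suc n) - c n) \<le> (\<Sum>n=m..<N. \<bar>c n - c (n + 1)\<bar>)"
      by (intro sum_mono) simp
    moreover have "(\<Sum>n=m..<N. \<bar>c n - c (n + 1)\<bar>) \<le> (\<Sum>n=m..2*m. \<bar>c n - c (n + 1)\<bar>)"
      using that by (intro sum_mono2) auto
    moreover have "c m \<le> S" using S[of 0] N0 by simp
    ultimately show ?thesis unfolding S_def[symmetric] by (simp add: distrib_right)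
  qed
  then show thesis using that[of N0 "1 + M"] N0 M by simp
qed

section \<open>From the series to cosine polynomials\<close>

text \<open>At \<open>x = 0\<close> the cosines are 1, so \<open>c\<close> is summable and its tails
  dominate those of the series for every \<open>x\<close>. The free \<open>m\<close> lets the
  truncation cover any prescribed index.\<close>

lemma cos_series_uniform_tail:
  fixes c :: "nat \<Rightarrow> real"
  assumes "\<And>j. 1 \<le> j \<Longrightarrow> 0 \<le> c j" "\<And>x. (\<lambda>j. c j * cos (real j * x)) sums f x" "0 < e"
  obtains J where "m \<le> J" "\<And>x. \<bar>f x - cos_partial_sum c J x\<bar> \<le> e"
proof -
  have sc: "summable c" using sums_summable[OF assms(2)[of 0]] by simp
  obtain N where N: "\<And>n. N \<le> n \<Longrightarrow> norm (\<Sum>i. c (i + n)) < e"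
    using suminf_exist_split[OF \<open>0 < e\<close> sc] by blast
  define J where "J = max m N"
  have "\<bar>f x - cos_partial_sum c J x\<bar> \<le> e" for x
  proof -
    \<comment> \<open>Shifted by \<open>Suc J\<close>, all indices are at least 1, where
      \<open>c\<close> is nonnegative.\<close>
    have sh: "summable (\<lambda>i. c (i + Suc J))" using sc by (simp only: summable_iff_shift)
    have le: "norm (c (i + Suc J) * cos (real (i + Suc J) * x)) \<le> c (i + Suc J)" for i
      using assms(1)[of "i + Suc J"] mult_left_mono[OF abs_cos_le_one[of "real (i + Suc J) * x"], of "c (i + Suc J)"]
      by (simp add: abs_mult)
    have "f x - cos_partial_sum c J x = (\<Sum>i. c (i + Suc J) * cos (real (i + Suc J) * x))"
      using suminf_minus_initial_segment[OF sums_summable[OF assms(2)[of x]], of "Suc J"] sums_unique[OF assms(2)[of x]]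
      by (simp add: cos_partial_sum_def lessThan_Suc_atMost)
    also have "\<bar>\<dots>\<bar> \<le> (\<Sum>i. c (i + Suc J))"
      using norm_suminf_le[OF le sh] by simp
    also have "\<dots> \<le> e" using N[of "Suc J"] by (simp add: J_def abs_less_iff le_Suc_eq)
    finally show ?thesis .
  qed
  then show thesis using that[of J] by (simp add: J_def)
qed

text \<open>Since \<open>f\<close> is even, the sine terms of the approximating polynomial can be averaged out.\<close>

lemma cos_poly_of_approximation:
  fixes c :: "nat \<Rightarrow> real"
  assumes "\<And>j. 1 \<le> j \<Longrightarrow> 0 \<le> c j" "\<And>x. (\<lambda>j. c j * cos (real j * x)) sums f x"
    and "t \<in> trig_polys n" "\<And>x. \<bar>f x - t x\<bar> \<le> B" "0 < e"
  obtains J d where "m \<le> J" "\<And>x. \<bar>\<Sum>j\<le>J. d j * cos (real j * x)\<bar> \<le> B + e" "\<And>j. n < j \<Longrightarrow> d j = c j"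
proof -
  obtain J where J: "max m n \<le> J" "\<And>x. \<bar>f x - cos_partial_sum c J x\<bar> \<le> e"
    using cos_series_uniform_tail[OF assms(1,2,5)] by blast
  obtain a b where t: "t = (\<lambda>x. \<Sum>k\<le>n. cos (real k * x) *\<^sub>R a k + sin (real k * x) *\<^sub>R b k)"
    using assms(3) by (auto simp: trig_polys_def)
  define d where "d j = c j - (if j \<le> n then a j else 0)" for j
  have even: "f (- x) = f x" for x
    using sums_unique2[OF assms(2)[of x]] assms(2)[of "- x"] by simp
  have "\<bar>\<Sum>j\<le>J. d j * cos (real j * x)\<bar> \<le> B + e" for x
  proof -
    have "(\<Sum>j\<le>J. (if j \<le> n then a j else 0) * cos (real j * x)) = (\<Sum>j\<le>n. a j * cos (real j * x))"
      using J(1) by (intro sum.mono_neutral_cong_right) auto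
    also have "\<dots> = (t x + t (- x)) / 2"
      by (simp add: t sum.distrib sum_negf mult.commute)
    finally have "(\<Sum>j\<le>J. d j * cos (real j * x)) = cos_partial_sum c J x - (t x + t (- x)) / 2"
      by (simp add: d_def left_diff_distrib sum_subtractf cos_partial_sum_def)
    then show ?thesis
      using J(2)[of x] assms(4)[of x] assms(4)[of "- x"] even[of x]
      by (simp add: abs_le_iff field_simps)
  qed
  then show thesis using that[of J d] J(1) by (simp add: d_def)
qed

text \<open>The polynomial bound passes to the series by truncating within \<open>e / 4\<close> and
  letting \<open>e\<close> tend to 0; the factor 4 turns \<open>e / 4\<close> into
  \<open>e\<close>.\<close>

lemma cos_coeff_tail_le:
  fixes c :: "nat \<Rightarrow> real"
  assumes "\<And>j. 1 \<le> j \<Longrightarrow> 0 \<le> c j" "\<And>x. (\<lambda>j. c j * cos (real j * x)) sums f x"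
    and "t \<in> trig_polys n" "\<And>x. \<bar>f x - t x\<bar> \<le> B" "1 \<le> n"
  shows "(\<Sum>j=2*n+1..m. c j) \<le> 4 * B"
proof (rule field_le_epsilon)
  fix e :: real assume "0 < e"
  then obtain J d where J: "m \<le> J" "\<And>x. \<bar>\<Sum>j\<le>J. d j * cos (real j * x)\<bar> \<le> B + e / 4"
    and d: "\<And>j. n < j \<Longrightarrow> d j = c j"
    using cos_poly_of_approximation[OF assms(1-4), of "e / 4" m] by auto
  have "(\<Sum>j=2*n+1..m. c j) \<le> (\<Sum>j=2*n+1..J. c j)"
    using J(1) by (intro sum_mono2) (auto intro: assms(1))
  also have "\<dots> = (\<Sum>j=2*n+1..J. d j)" by (intro sum.cong) (auto simp: d)
  also have "\<dots> \<le> 4 * (B + e / 4)"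
    using assms(1) by (intro cos_poly_tail_le[OF assms(5) J(2)]) (auto simp: d)
  finally show "(\<Sum>j=2*n+1..m. c j) \<le> 4 * B + e" by simp
qed

lemma cos_coeff_block_le:
  fixes c :: "nat \<Rightarrow> real"
  assumes "\<And>j. 1 \<le> j \<Longrightarrow> 0 \<le> c j" "\<And>x. (\<lambda>j. c j * cos (real j * x)) sums f x"
    and "t \<in> trig_polys n" "\<And>x. \<bar>f x - t x\<bar> \<le> B" "1 \<le> k"
  shows "(\<Sum>j=n + k - k div 2..n + k. c j) \<le> 4 * B" "c (n + k) \<le> 2 * B"
proof -
  have "(\<Sum>j=n + k - k div 2..n + k. c j) \<le> 4 * B + e \<and> c (n + k) \<le> 2 * B + e" if "0 < e" for e
  proof -
    have "0 < e / 4" using that by simp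
    then obtain J d where J: "n + k \<le> J" "\<And>x. \<bar>\<Sum>j\<le>J. d j * cos (real j * x)\<bar> \<le> B + e / 4"
      and d: "\<And>j. n < j \<Longrightarrow> d j = c j"
      using cos_poly_of_approximation[OF assms(1-4), of "e / 4" "n + k"] by blast
    have d0: "\<And>j. n < j \<Longrightarrow> 0 \<le> d j" using assms(1) by (simp add: d)
    \<comment> \<open>\<open>k \<ge> 1\<close> puts the window strictly above \<open>n\<close>,
      where \<open>d\<close> and \<open>c\<close> agree.\<close>
    have "(\<Sum>j=n + k - k div 2..n + k. c j) = (\<Sum>j=n + k - k div 2..n + k. d j)"
      using assms(5) by (intro sum.cong) (auto simp: d)
    moreover have "c (n + k) = d (n + k)" using assms(5) by (simp add: d)
    ultimately show ?thesis
      using cos_poly_block_le[OF assms(5) J d0] that by auto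
  qed
  then show "(\<Sum>j=n + k - k div 2..n + k. c j) \<le> 4 * B" "c (n + k) \<le> 2 * B"
    by (auto intro: field_le_epsilon)
qed

section \<open>Single coefficients against the approximation error\<close>

text \<open>By the GBV condition a single coefficient at \<open>n + k\<close> forces all windows starting in
  \<open>{n + k - k div 2..n + k}\<close> to carry comparable mass, so a block of length about \<open>k\<close> sums to
  at least a multiple of \<open>k * c (n + k)\<close>.\<close>

lemma GBV_coeff_le_approximation:
  assumes "c \<in> GBV" "\<And>x. (\<lambda>j. c j * cos (real j * x)) sums f x"
  obtains K where "0 < K"
    "\<And>n k t B. 1 \<le> k \<Longrightarrow> k \<le> n \<Longrightarrow> t \<in> trig_polys n \<Longrightarrow> (\<And>x. \<bar>f x - t x\<bar> \<le> B) \<Longrightarrow>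
      real k * c (n + k) \<le> K * B"
proof -
  have c: "\<And>j. 1 \<le> j \<Longrightarrow> 0 \<le> c j" using assms(1) by (simp add: GBV_def)
  obtain N0 M where N0: "1 \<le> N0" and M: "0 < M"
    and cM: "\<And>m N. 1 \<le> m \<Longrightarrow> m \<le> N \<Longrightarrow> N \<le> 2 * m \<Longrightarrow> c N \<le> M * (\<Sum>i<N0. c (m + i))"
    using GBV_coeff_le[OF assms(1)] by blast
  \<comment> \<open>The factors come from \<open>k \<le> 2 * card I\<close>, the GBV constant, the
    \<open>N0\<close> shifts and the bound for each shifted sum.\<close>
  define K where "K = 2 * M * real N0 * (4 + 2 * real N0)"
  have "real k * c (n + k) \<le> K * B"
    if k: "1 \<le> k" "k \<le> n" and t: "t \<in> trig_polys n" "\<And>x. \<bar>f x - t x\<bar> \<le> B" for n k t B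
  proof -
    define N where "N = n + k"
    define I where "I = {N - k div 2..N}"
    note block = cos_coeff_block_le[OF c assms(2) t]
    have "B \<ge> 0" using t(2)[of 0] by linarith
    \<comment> \<open>A shifted window leaves \<open>I\<close> by at most \<open>N0\<close> indices,
      each handled by the pointwise bound, which holds at every index above
      \<open>n\<close>.\<close>
    have inner: "(\<Sum>m\<in>I. c (m + i)) \<le> 4 * B + real N0 * (2 * B)" if i: "i < N0" for i
    proof -
      have "(\<Sum>m\<in>I. c (m + i)) = (\<Sum>j=N - k div 2 + i..N + i. c j)"
        unfolding I_def by (rule sum.shift_bounds_cl_nat_ivl[symmetric])
      also have "\<dots> \<le> (\<Sum>j\<in>I \<union> {N<..N + N0}. c j)"
        using i k by (intro sum_mono2) (auto simp: I_def N_def intro!: c)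
      also have "\<dots> = (\<Sum>j\<in>I. c j) + (\<Sum>j\<in>{N<..N + N0}. c j)"
        by (intro sum.union_disjoint) (auto simp: I_def)
      also have "(\<Sum>j\<in>I. c j) \<le> 4 * B" using block(1)[OF _ k(1)] by (simp add: I_def N_def)
      also have "(\<Sum>j\<in>{N<..N + N0}. c j) \<le> real (card {N<..N + N0}) * (2 * B)"
      proof (rule sum_bounded_above)
        fix j assume "j \<in> {N<..N + N0}"
        then have "1 \<le> j - n" "n + (j - n) = j" using k by (auto simp: N_def)
        then show "c j \<le> 2 * B" using block(2)[of "j - n"] by simp
      qed
      finally show ?thesis by simp
    qed
    have "real (card I) * c N = (\<Sum>m\<in>I. c N)" by simp
    \<comment> \<open>Every \<open>m\<close> in \<open>I\<close> satisfies
      \<open>2 * m \<ge> 2 * N - k \<ge> N\<close>.\<close>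
    also have "\<dots> \<le> (\<Sum>m\<in>I. M * (\<Sum>i<N0. c (m + i)))"
      using k by (intro sum_mono cM) (auto simp: I_def N_def)
    also have "\<dots> = M * (\<Sum>i<N0. \<Sum>m\<in>I. c (m + i))"
      unfolding sum_distrib_left[symmetric] by (subst sum.swap) simp
    also have "\<dots> \<le> M * (\<Sum>i<N0. 4 * B + real N0 * (2 * B))"
      using M inner by (intro mult_left_mono sum_mono) auto
    also have "\<dots> = K / 2 * B" by (simp add: K_def algebra_simps)
    finally have *: "real (card I) * c N \<le> K / 2 * B" .
    have "real k \<le> 2 * real (card I)"
      using k by (simp add: I_def N_def)
    then have "real k * c N \<le> 2 * real (card I) * c N"
      using k by (intro mult_right_mono c) (auto simp: N_def)
    then show ?thesis using * by (simp add: N_def)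
  qed
  moreover have "0 < K" using M N0 by (simp add: K_def)
  ultimately show thesis using that by blast
qed

section \<open>Error of the partial sums and conclusion\<close>

text \<open>Together with the boundedness of \<open>f\<close> this makes the supremum in
  \<open>sup_norm\<close> a genuine upper bound.\<close>

lemma trig_poly_bounded:
  assumes "t \<in> trig_polys n"
  obtains A where "\<And>x. norm (t x) \<le> A"
proof -
  obtain a b where t: "t = (\<lambda>x. \<Sum>k\<le>n. cos (real k * x) *\<^sub>R a k + sin (real k * x) *\<^sub>R b k)"
    using assms by (auto simp: trig_polys_def)
  have "norm (t x) \<le> (\<Sum>k\<le>n. norm (a k) + norm (b k))" for x
    unfolding t
    by (intro sum_norm_le norm_triangle_mono) (simp_all add: mult_left_le_one_le)
  then show thesis using that by blast
qed

lemma cos_series_bounded: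
  fixes c :: "nat \<Rightarrow> real"
  assumes "\<And>j. 1 \<le> j \<Longrightarrow> 0 \<le> c j" "\<And>x. (\<lambda>j. c j * cos (real j * x)) sums f x"
  obtains A where "\<And>x. \<bar>f x\<bar> \<le> A"
proof -
  obtain J where J: "\<And>x. \<bar>f x - cos_partial_sum c J x\<bar> \<le> 1"
    using cos_series_uniform_tail[OF assms zero_less_one] by blast
  have S: "\<bar>cos_partial_sum c J x\<bar> \<le> (\<Sum>j\<le>J. \<bar>c j\<bar>)" for x
    unfolding cos_partial_sum_def
    by (intro order_trans[OF sum_abs] sum_mono) (simp add: abs_mult mult_left_le)
  have "\<bar>f x\<bar> \<le> 1 + (\<Sum>j\<le>J. \<bar>c j\<bar>)" for x
    using J[of x] S[of x] by linarith
  then show thesis using that by blast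
qed

text \<open>Differences of partial sums are bounded through \<open>\<bar>cos y\<bar> \<le> 1\<close>
  and nonnegativity, and the bound survives the limit.\<close>

lemma cos_partial_sum_error_le:
  fixes c :: "nat \<Rightarrow> real"
  assumes "\<And>j. 1 \<le> j \<Longrightarrow> 0 \<le> c j" "\<And>x. (\<lambda>j. c j * cos (real j * x)) sums f x"
    and "\<And>m. (\<Sum>j=n+1..m. c j) \<le> A"
  shows "\<bar>f x - cos_partial_sum c n x\<bar> \<le> A"
proof -
  have lim: "(\<lambda>m. \<bar>cos_partial_sum c m x - cos_partial_sum c n x\<bar>) \<longlonglongrightarrow> \<bar>f x - cos_partial_sum c n x\<bar>"
    using assms(2)[of x] unfolding sums_def_le cos_partial_sum_def by (intro tendsto_intros)
  have "\<bar>cos_partial_sum c m x - cos_partial_sum c n x\<bar> \<le> A" if "n \<le> m" for m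
  proof -
    have "{..m} = {..n} \<union> {n+1..m}" using that by auto
    then have "cos_partial_sum c m x - cos_partial_sum c n x = (\<Sum>j=n+1..m. c j * cos (real j * x))"
      unfolding cos_partial_sum_def by (simp add: sum.union_disjoint)
    also have "\<bar>\<dots>\<bar> \<le> (\<Sum>j=n+1..m. c j)"
      using assms(1) by (intro order_trans[OF sum_abs] sum_mono) (simp add: abs_mult mult_left_le)
    finally show ?thesis using assms(3)[of m] by simp
  qed
  then show ?thesis by (intro LIMSEQ_le_const2[OF lim]) blast
qed

theorem theorem3:
  fixes fhat :: "nat \<Rightarrow> real" and f :: "real \<Rightarrow> real"
  assumes "fhat \<in> GBV"
    and "\<And>x. (\<lambda>n. fhat n * cos (real n * x)) sums f x"
    and "f \<in> C2pi"
    and "\<exists>C>0. \<forall>n\<ge>1.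
      \<bar>\<Sum>k=n+1..2*n. fhat k\<bar> \<le> C * \<bar>Max ((\<lambda>k. real k * fhat (n + k)) ` {1..n})\<bar>"
  shows "\<exists>C>0. \<forall>n\<ge>1.
      sup_norm (\<lambda>x. f x - cos_partial_sum fhat n x) \<le> C * best_approx n f"
proof -
  have c: "\<And>j. 1 \<le> j \<Longrightarrow> 0 \<le> fhat j" using assms(1) by (simp add: GBV_def)
  obtain K where K: "0 < K" "\<And>n k t B. 1 \<le> k \<Longrightarrow> k \<le> n \<Longrightarrow> t \<in> trig_polys n \<Longrightarrow>
      (\<And>x. \<bar>f x - t x\<bar> \<le> B) \<Longrightarrow> real k * fhat (n + k) \<le> K * B"
    using GBV_coeff_le_approximation[OF assms(1,2)] by blast
  obtain C where C: "0 < C" "\<And>n. 1 \<le> n \<Longrightarrow>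
      \<bar>\<Sum>k=n+1..2*n. fhat k\<bar> \<le> C * \<bar>Max ((\<lambda>k. real k * fhat (n + k)) ` {1..n})\<bar>"
    using assms(4) by blast
  \<comment> \<open>\<open>C * K\<close> serves the block from \<open>n + 1\<close> to
    \<open>2 * n\<close>, and 4 the coefficients beyond.\<close>
  define D where "D = C * K + 4"
  have D: "0 < D" using C(1) K(1) by (simp add: D_def add_pos_pos)
  have "sup_norm (\<lambda>x. f x - cos_partial_sum fhat n x) \<le> D * sup_norm (\<lambda>x. f x - t x)"
    if n: "1 \<le> n" and t: "t \<in> trig_polys n" for n and t :: "real \<Rightarrow> real"
  proof -
    define B where "B = sup_norm (\<lambda>x. f x - t x)"
    obtain A1 A2 where A: "\<And>x. \<bar>f x\<bar> \<le> A1" "\<And>x. norm (t x) \<le> A2"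
      using cos_series_bounded[OF c assms(2)] trig_poly_bounded[OF t] by metis
    have "bdd_above (range (\<lambda>x. norm (f x - t x)))"
    proof (rule bdd_aboveI2)
      fix x show "norm (f x - t x) \<le> A1 + A2"
        using norm_triangle_ineq4[of "f x" "t x"] A(1)[of x] A(2)[of x] by simp
    qed
    then have B: "\<bar>f x - t x\<bar> \<le> B" for x
      unfolding B_def sup_norm_def using cSUP_upper[of x UNIV "\<lambda>x. norm (f x - t x)"] by simp
    define X where "X = (\<lambda>k. real k * fhat (n + k)) ` {1..n}"
    \<comment> \<open>The maximum is attained at some \<open>k\<close>, so the coefficient estimate
      applies to it; nonnegativity removes the absolute value.\<close>
    have "Max X \<in> X" unfolding X_def using n by (intro Max_in) auto
    then obtain k where k: "1 \<le> k" "k \<le> n" "Max X = real k * fhat (n + k)"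
      unfolding X_def by auto
    then have "\<bar>Max X\<bar> \<le> K * B"
      using K(2)[OF k(1,2) t B] c[of "n + k"] by simp
    then have "C * \<bar>Max X\<bar> \<le> C * (K * B)"
      using C(1) by (simp add: mult_left_mono)
    then have head: "(\<Sum>j=n+1..2*n. fhat j) \<le> C * (K * B)"
      using C(2)[OF n] unfolding X_def by linarith
    \<comment> \<open>Only an inequality, since \<open>m\<close> may lie below \<open>2 * n\<close>;
      the added terms are nonnegative.\<close>
    have split: "(\<Sum>j=n+1..m. fhat j) \<le> (\<Sum>j=n+1..2*n. fhat j) + (\<Sum>j=2*n+1..m. fhat j)" for m
    proof -
      have "(\<Sum>j=n+1..m. fhat j) \<le> (\<Sum>j\<in>{n+1..2*n} \<union> {2*n+1..m}. fhat j)"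
        by (intro sum_mono2) (auto intro: c)
      then show ?thesis by (simp add: sum.union_disjoint)
    qed
    have tail: "(\<Sum>j=2*n+1..m. fhat j) \<le> 4 * B" for m
      using c assms(2) t B n by (rule cos_coeff_tail_le)
    have total: "(\<Sum>j=n+1..m. fhat j) \<le> D * B" for m
      using head split[of m] tail[of m] by (simp add: D_def distrib_right mult.assoc)
    have "\<bar>f x - cos_partial_sum fhat n x\<bar> \<le> D * B" for x
      using c assms(2) total by (rule cos_partial_sum_error_le)
    then show ?thesis
      unfolding sup_norm_def[of "\<lambda>x. f x - cos_partial_sum fhat n x"] B_def[symmetric]
      by (intro cSUP_least) auto
  qed
  \<comment> \<open>A lower bound of a nonempty set lies below its infimum, so dividing by
    \<open>D\<close> carries the bound for each \<open>t\<close> over to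
    \<open>best_approx n f\<close>.\<close>
  moreover have "trig_polys n \<noteq> ({} :: (real \<Rightarrow> real) set)" for n
    by (auto simp: trig_polys_def)
  ultimately have "sup_norm (\<lambda>x. f x - cos_partial_sum fhat n x) / D \<le> best_approx n f" if "1 \<le> n" for n
    unfolding best_approx_def using that D
    by (intro cINF_greatest) (auto simp: divide_le_eq mult.commute)
  then show ?thesis
    using D by (intro exI[of _ D]) (auto simp: divide_le_eq mult.commute)
qed

end
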